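(* Let $G$ be a finite graph without isolated vertices. Then all complex roots of its edge cover polynomial $\mathcal{E}(G,z)$ are contained in the set $\{-(1-\alpha)^2 : \alpha\in\mathbb{C},\ |\alpha|\le 1\}$.
   Context: For a graph $G=(V,E)$, a subset $F\subseteq E$ is an edge cover if each vertex of $G$ is contained in at least one edge of $F$. The edge cover polynomial is $\mathcal{E}(G,z)=\sum_{F\subseteq E\text{ edge cover}} z^{|F|}$. A vertex is isolated if it is contained in no edge. *)

theory Defs
  imports Complex_Main "HOL-Computational_Algebra.Polynomial"
begin

text \<open>An undirected edge is the set of its two (distinct) end vertices, so neither loops nor
  parallel edges occur. The graph with no vertices is allowed.\<close>

locale fin_graph =
  fixes V :: "'a set" and E :: "'a set set"
  assumes finite_vertices: "finite V"
    and edge_subset: "e \<in> E \<Longrightarrow> e \<subseteq> V"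
    and card_edge: "e \<in> E \<Longrightarrow> card e = 2"

definition isolated :: "'a set \<Rightarrow> 'a set set \<Rightarrow> 'a \<Rightarrow> bool" where
  "isolated V E v \<longleftrightarrow> v \<in> V \<and> (\<forall>e\<in>E. v \<notin> e)"

definition edge_cover :: "'a set \<Rightarrow> 'a set set \<Rightarrow> 'a set set \<Rightarrow> bool" where
  "edge_cover V E F \<longleftrightarrow> F \<subseteq> E \<and> (\<forall>v\<in>V. \<exists>e\<in>F. v \<in> e)"

definition edge_cover_poly :: "'a set \<Rightarrow> 'a set set \<Rightarrow> complex poly" where
  "edge_cover_poly V E = (\<Sum>F | edge_cover V E F. monom 1 (card F))"

end

theory Submission
  imports Defs "HOL-Library.Disjoint_Sets"
begin

text \<open>
  The proof is an Asano contraction argument. Give every half-edge \<open>(v, e)\<close>, \<open>v \<in> e\<close>, its own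
  variable, let a set \<open>T\<close> of half-edges record those that are \<^emph>\<open>left out\<close>, and let \<open>c T\<close> be \<open>1\<close> if
  every vertex keeps some half-edge outside \<open>T\<close> and \<open>0\<close> otherwise. The multiaffine polynomial
  \<open>\<Sum>T. c T * (\<Prod>t\<in>T. u t)\<close> then factors over the vertices into terms
  \<open>(\<Prod>t. 1 + u t) - (\<Prod>t. u t)\<close>, one for each star. Since \<open>norm (1 + x) > norm x\<close> exactly when
  \<open>Re x > -1/2\<close>, no factor of a nonisolated vertex vanishes while all variables lie in this open
  half-plane.

  Now join the two halves of each edge: \<open>A + B x + C y + D x y\<close> is replaced by \<open>A + D w\<close>. If the
  former does not vanish for \<open>x\<close>, \<open>y\<close> in the half-plane, then setting \<open>x = y\<close> yields a
  quadratic whose two roots lie in the complementary half-plane, and the zero \<open>-A / D\<close> of the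
  latter is minus the product of these roots. Such a product is a square \<open>k\<^sup>2\<close> with
  \<open>Re k \<ge> 1/2\<close>. After all edges have been joined, the polynomial is
  \<open>\<Sum>F. w ^ card F\<close> over the complements \<open>F\<close> of edge covers, that is,
  \<open>w ^ card E\<close> times the edge cover polynomial at \<open>1 / w\<close>. So a nonzero root \<open>z\<close> has
  \<open>1 / z = - k\<^sup>2\<close> with \<open>Re k \<ge> 1/2\<close>, and inversion maps that half-plane into the disc of all \<open>1 - \<alpha>\<close>
  with \<open>norm \<alpha> \<le> 1\<close>.

  Leaving edges out, rather than choosing them, is what makes the argument smooth: the region
  without zeros contains the origin, so \<open>A\<close> never vanishes. Hence \<open>A + D w\<close> cannot vanish
  when \<open>D = 0\<close>, the case in which there is no quadratic.
\<close>

section \<open>Products in a half-plane\<close>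

text \<open>For \<open>s = csqrt a\<close> and \<open>t = csqrt b\<close>, the real parts of \<open>a\<close> and \<open>b\<close> are values of the Lorentz
  form \<open>(Re s)\<^sup>2 - (Im s)\<^sup>2\<close>, and \<open>Re (s * t)\<close> is the corresponding bilinear form. The bound is the
  reversed Cauchy-Schwarz inequality for that form.\<close>

lemma half_plane_mult_is_square:
  fixes a b :: complex
  assumes a: "Re a \<ge> r" and b: "Re b \<ge> r" and r: "r \<ge> 0"
  obtains k where "Re k \<ge> r" "a * b = k\<^sup>2"
proof
  define s t where "s = csqrt a" and "t = csqrt b"
  have s2: "s\<^sup>2 = a" and t2: "t\<^sup>2 = b" by (simp_all add: s_def t_def)
  show "a * b = (s * t)\<^sup>2" by (simp add: power_mult_distrib s2 t2)
  have Re_s: "Re s \<ge> 0" and Re_t: "Re t \<ge> 0"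
    using csqrt_principal[of a] csqrt_principal[of b] by (auto simp: s_def t_def)
  have sa: "(Re s)\<^sup>2 - (Im s)\<^sup>2 = Re a" and tb: "(Re t)\<^sup>2 - (Im t)\<^sup>2 = Re b"
    using s2 t2 by (auto simp: complex_eq_iff power2_eq_square)
  have "\<bar>Im s\<bar> \<le> Re s" "\<bar>Im t\<bar> \<le> Re t"
    using sa tb a b r
    unfolding power2_le_iff_abs_le[OF Re_s, symmetric] power2_le_iff_abs_le[OF Re_t, symmetric]
    by linarith+
  then have "\<bar>Im s * Im t\<bar> \<le> Re s * Re t"
    unfolding abs_mult using Re_s by (intro mult_mono) auto
  then have nonneg: "Re s * Re t - Im s * Im t \<ge> 0" by linarith
  have "r\<^sup>2 \<le> Re a * Re b"
    unfolding power2_eq_square using a b r by (intro mult_mono) auto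
  also have "\<dots> = (Re s * Re t - Im s * Im t)\<^sup>2 - (Re s * Im t - Re t * Im s)\<^sup>2"
    unfolding sa[symmetric] tb[symmetric] by (simp add: power2_eq_square algebra_simps)
  also have "\<dots> \<le> (Re s * Re t - Im s * Im t)\<^sup>2" by simp
  finally show "Re (s * t) \<ge> r"
    using power2_le_imp_le[OF _ nonneg] by simp
qed

lemma quadratic_factorisation:
  fixes A S D :: complex
  assumes "D \<noteq> 0"
  obtains p q where "\<And>x. A + S * x + D * x\<^sup>2 = D * (x - p) * (x - q)"
proof
  define d where "d = csqrt (S\<^sup>2 - 4 * A * D)"
  have d: "d * d = S * S - 4 * A * D"
    using power2_csqrt[of "S\<^sup>2 - 4 * A * D"] by (simp add: d_def power2_eq_square)
  fix x
  have "4 * D * (A + S * x + D * x\<^sup>2) = (2 * D * x + S) * (2 * D * x + S) - d * d"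
    unfolding d by (simp add: power2_eq_square algebra_simps)
  also have "\<dots> = (2 * D * x - (- S + d)) * (2 * D * x - (- S - d))"
    by (simp add: algebra_simps)
  also have "\<dots> = 4 * D * (D * (x - (- S + d) / (2 * D)) * (x - (- S - d) / (2 * D)))"
    using assms by (simp add: field_simps)
  finally show "A + S * x + D * x\<^sup>2 = D * (x - (- S + d) / (2 * D)) * (x - (- S - d) / (2 * D))"
    using assms by simp
qed

text \<open>Asano's contraction for one pair of variables. On the diagonal \<open>x = y\<close> the polynomial is a
  quadratic with roots \<open>p\<close> and \<open>q\<close> outside the half-plane and with \<open>A = D * p * q\<close>.\<close>

lemma asano_contraction:
  fixes A B C D w :: complex
  assumes nz: "\<And>x y. Re x > -1/2 \<Longrightarrow> Re y > -1/2 \<Longrightarrow> A + B * x + C * y + D * (x * y) \<noteq> 0"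
    and w: "\<And>k. Re k \<ge> 1/2 \<Longrightarrow> w \<noteq> - k\<^sup>2"
  shows "A + w * D \<noteq> 0"
proof (cases "D = 0")
  case True
  with nz[of 0 0] show ?thesis by simp
next
  case False
  then obtain p q where pq: "\<And>x. A + (B + C) * x + D * x\<^sup>2 = D * (x - p) * (x - q)"
    using quadratic_factorisation by blast
  have diag: "D * (x - p) * (x - q) \<noteq> 0" if "Re x > -1/2" for x
    using nz[OF that that] unfolding pq[symmetric] by (simp add: power2_eq_square algebra_simps)
  have "Re (- p) \<ge> 1/2" "Re (- q) \<ge> 1/2"
    using diag[of p] diag[of q] by force+
  then obtain k where k: "Re k \<ge> 1/2" "- p * - q = k\<^sup>2"
    by (rule half_plane_mult_is_square) auto
  have "A = D * k\<^sup>2" using pq[of 0] k(2) by simp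
  moreover have "k\<^sup>2 + w \<noteq> 0" using w[OF k(1)] by (metis add_eq_0_iff)
  ultimately show ?thesis using False
    by (metis distrib_left mult.commute mult_eq_0_iff)
qed

section \<open>Multiaffine polynomials\<close>

definition multiaffine :: "'b set \<Rightarrow> ('b set \<Rightarrow> complex) \<Rightarrow> ('b \<Rightarrow> complex) \<Rightarrow> complex" where
  "multiaffine H c u = (\<Sum>T\<in>Pow H. c T * (\<Prod>t\<in>T. u t))"

definition half_plane_nonzero :: "'b set \<Rightarrow> ('b set \<Rightarrow> complex) \<Rightarrow> bool" where
  "half_plane_nonzero H c \<longleftrightarrow> (\<forall>u. (\<forall>h\<in>H. Re (u h) > -1/2) \<longrightarrow> multiaffine H c u \<noteq> 0)"

lemma sum_Pow_insert:
  assumes "finite H" "h \<notin> H"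
  shows "(\<Sum>T\<in>Pow (insert h H). f T) = (\<Sum>T\<in>Pow H. f T) + (\<Sum>T\<in>Pow H. f (insert h T))"
proof -
  have "inj_on (insert h) (Pow H)"
    using assms(2) by (auto simp: inj_on_def)
  moreover have "Pow H \<inter> insert h ` Pow H = {}"
    using assms(2) by auto
  ultimately show ?thesis
    using assms(1) by (simp add: Pow_insert sum.union_disjoint sum.reindex)
qed

lemma multiaffine_insert:
  assumes "finite H" "h \<notin> H"
  shows "multiaffine (insert h H) c u
    = multiaffine H c u + u h * multiaffine H (\<lambda>T. c (insert h T)) u"
proof -
  have "(\<Prod>t\<in>insert h T. u t) = u h * (\<Prod>t\<in>T. u t)" if "T \<in> Pow H" for T
    using that assms by (subst prod.insert) (auto intro: finite_subset)
  then show ?thesis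
    unfolding multiaffine_def sum_Pow_insert[OF assms] sum_distrib_left
    by (simp add: mult_ac)
qed

lemma multiaffine_cong:
  assumes "\<And>t. t \<in> H \<Longrightarrow> u t = u' t"
  shows "multiaffine H c u = multiaffine H c u'"
  unfolding multiaffine_def
proof (rule sum.cong)
  fix T assume "T \<in> Pow H"
  then have "(\<Prod>t\<in>T. u t) = (\<Prod>t\<in>T. u' t)" using assms by (intro prod.cong) auto
  then show "c T * (\<Prod>t\<in>T. u t) = c T * (\<Prod>t\<in>T. u' t)" by simp
qed simp

lemma half_plane_nonzero_contract:
  assumes fin: "finite H" and new: "a \<notin> H" "b \<notin> H" "a \<noteq> b"
    and nz: "half_plane_nonzero (insert a (insert b H)) c"
    and w: "\<And>k. Re k \<ge> 1/2 \<Longrightarrow> w \<noteq> - k\<^sup>2"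
  shows "half_plane_nonzero H (\<lambda>T. c T + w * c (insert a (insert b T)))"
  unfolding half_plane_nonzero_def
proof (intro allI impI)
  fix u assume u: "\<forall>h\<in>H. Re (u h) > -1/2"
  define M where "M g = multiaffine H (\<lambda>T. c (g T)) u" for g :: "'a set \<Rightarrow> 'a set"
  have "M (\<lambda>T. T) + w * M (\<lambda>T. insert a (insert b T)) \<noteq> 0"
  proof (rule asano_contraction)
    fix x y :: complex assume xy: "Re x > -1/2" "Re y > -1/2"
    define u' where "u' = u(a := x, b := y)"
    have M: "multiaffine H (\<lambda>T. c (g T)) u' = M g" for g
      unfolding M_def by (rule multiaffine_cong) (use new in \<open>auto simp: u'_def\<close>)
    have "multiaffine (insert a (insert b H)) c u' \<noteq> 0"
      using nz u xy unfolding half_plane_nonzero_def by (auto simp: u'_def)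
    also have "multiaffine (insert a (insert b H)) c u'
      = M (\<lambda>T. T) + M (insert a) * x + M (insert b) * y
        + M (\<lambda>T. insert a (insert b T)) * (x * y)"
      using fin new by (simp add: multiaffine_insert M M[of "\<lambda>T. T"])
        (simp add: u'_def algebra_simps)
    finally show "M (\<lambda>T. T) + M (insert a) * x + M (insert b) * y
      + M (\<lambda>T. insert a (insert b T)) * (x * y) \<noteq> 0" .
  qed (rule w)
  then show "multiaffine H (\<lambda>T. c T + w * c (insert a (insert b T))) u \<noteq> 0"
    by (simp add: M_def multiaffine_def sum.distrib sum_distrib_left algebra_simps)
qed

text \<open>Contracting all pairs \<open>h e\<close> leaves no variable; the surviving coefficients are those of the
  unions of pairs. The coefficient function \<open>c\<close> is generalised in the induction because each
  contraction changes it.\<close>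

lemma contract_all_pairs:
  fixes c :: "'b set \<Rightarrow> complex"
  assumes "finite E"
    and "\<And>e. e \<in> E \<Longrightarrow> card (h e) = 2"
    and "disjoint_family_on h E"
    and "half_plane_nonzero (\<Union>e\<in>E. h e) c"
    and w: "\<And>k. Re k \<ge> 1/2 \<Longrightarrow> w \<noteq> - k\<^sup>2"
  shows "(\<Sum>F\<in>Pow E. w ^ card F * c (\<Union>e\<in>F. h e)) \<noteq> 0"
  using assms(1-4)
proof (induction E arbitrary: c rule: finite_induct)
  case empty
  then show ?case by (simp add: half_plane_nonzero_def multiaffine_def)
next
  case (insert e E)
  obtain a b where ab: "h e = {a, b}" "a \<noteq> b"
    using insert.prems(1)[of e] by (auto simp: card_2_iff)
  define H where "H = (\<Union>e\<in>E. h e)"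
  have "finite (h e')" if "e' \<in> E" for e'
    using insert.prems(1)[of e'] that by (intro card_ge_0_finite) simp
  then have finH: "finite H" using insert.hyps(1) by (simp add: H_def)
  have "h e \<inter> H = {}"
    using disjoint_family_on_insert[OF insert.hyps(2), of h] insert.prems(2) by (simp add: H_def)
  then have new: "a \<notin> H" "b \<notin> H" using ab by auto
  let ?c = "\<lambda>T. c T + w * c (insert a (insert b T))"
  have "half_plane_nonzero H ?c"
    using insert.prems(3) ab by (intro half_plane_nonzero_contract finH new w) (auto simp: H_def)
  then have "(\<Sum>F\<in>Pow E. w ^ card F * ?c (\<Union>e\<in>F. h e)) \<noteq> 0"
    using insert.prems(1,2)
    by (intro insert.IH) (auto simp: H_def disjoint_family_on_def)
  also have "(\<Sum>F\<in>Pow E. w ^ card F * ?c (\<Union>e\<in>F. h e))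
    = (\<Sum>F\<in>Pow E. w ^ card F * c (\<Union>e\<in>F. h e)
        + w ^ card (insert e F) * c (\<Union>e\<in>insert e F. h e))"
  proof (rule sum.cong)
    fix F assume "F \<in> Pow E"
    then have "card (insert e F) = Suc (card F)"
      using insert.hyps by (subst card_insert_disjoint) (auto intro: finite_subset)
    then show "w ^ card F * ?c (\<Union>e\<in>F. h e) = w ^ card F * c (\<Union>e\<in>F. h e)
        + w ^ card (insert e F) * c (\<Union>e\<in>insert e F. h e)"
      by (simp add: ab distrib_left)
  qed simp
  also have "\<dots> = (\<Sum>F\<in>Pow (insert e E). w ^ card F * c (\<Union>e\<in>F. h e))"
    unfolding sum_Pow_insert[OF insert.hyps] sum.distrib ..
  finally show ?case .
qed

text \<open>Coefficients that are products over blocks of variables give polynomials that are products,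
  since a subset of a union of disjoint blocks is a choice of a subset of each block.\<close>

lemma multiaffine_Un:
  assumes disj: "H \<inter> K = {}" and fin: "finite H" "finite K"
  shows "multiaffine (H \<union> K) (\<lambda>T. c (T \<inter> H) * d (T \<inter> K)) u = multiaffine H c u * multiaffine K d u"
proof -
  have "multiaffine H c u * multiaffine K d u
    = (\<Sum>(S, T)\<in>Pow H \<times> Pow K. (c S * (\<Prod>t\<in>S. u t)) * (d T * (\<Prod>t\<in>T. u t)))"
    unfolding multiaffine_def sum_product by (simp add: sum.cartesian_product)
  also have "\<dots> = multiaffine (H \<union> K) (\<lambda>T. c (T \<inter> H) * d (T \<inter> K)) u"
    unfolding multiaffine_def
  proof (rule sum.reindex_bij_witness[where i = "\<lambda>T. (T \<inter> H, T \<inter> K)" and j = "\<lambda>(S, T). S \<union> T"])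
    fix p assume "p \<in> Pow H \<times> Pow K"
    then obtain S T where p: "p = (S, T)" and ST: "S \<subseteq> H" "T \<subseteq> K" by auto
    have "(S \<union> T) \<inter> H = S" "(S \<union> T) \<inter> K = T" using ST disj by auto
    moreover have "(\<Prod>t\<in>S \<union> T. u t) = (\<Prod>t\<in>S. u t) * (\<Prod>t\<in>T. u t)"
      using ST disj fin by (intro prod.union_disjoint) (auto intro: finite_subset)
    ultimately show
      "c ((case p of (S, T) \<Rightarrow> S \<union> T) \<inter> H) * d ((case p of (S, T) \<Rightarrow> S \<union> T) \<inter> K)
        * (\<Prod>t\<in>(case p of (S, T) \<Rightarrow> S \<union> T). u t)
      = (case p of (S, T) \<Rightarrow> (c S * (\<Prod>t\<in>S. u t)) * (d T * (\<Prod>t\<in>T. u t)))"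
      by (simp add: p mult_ac)
  qed (use disj in auto)
  finally show ?thesis by simp
qed

lemma half_plane_nonzero_UN:
  assumes "finite I"
    and "\<And>i. i \<in> I \<Longrightarrow> finite (H i)"
    and "disjoint_family_on H I"
    and "\<And>i. i \<in> I \<Longrightarrow> half_plane_nonzero (H i) (c i)"
  shows "half_plane_nonzero (\<Union>i\<in>I. H i) (\<lambda>T. \<Prod>i\<in>I. c i (T \<inter> H i))"
  using assms
proof (induction I rule: finite_induct)
  case empty
  then show ?case by (simp add: half_plane_nonzero_def multiaffine_def)
next
  case (insert i I)
  let ?K = "\<Union>i\<in>I. H i"
  let ?d = "\<lambda>T. \<Prod>i\<in>I. c i (T \<inter> H i)"
  have disj: "H i \<inter> ?K = {}"
    using disjoint_family_on_insert[OF insert.hyps(2), of H] insert.prems(2) by simp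
  have IH: "half_plane_nonzero ?K ?d"
    using insert.prems by (intro insert.IH) (auto simp: disjoint_family_on_def)
  have "?d (T \<inter> ?K) = ?d T" for T
    by (intro prod.cong arg_cong[where f = "c _"]) auto
  then have coeff: "(\<lambda>T. \<Prod>j\<in>insert i I. c j (T \<inter> H j)) = (\<lambda>T. c i (T \<inter> H i) * ?d (T \<inter> ?K))"
    using insert.hyps by simp
  have "multiaffine (H i \<union> ?K) (\<lambda>T. c i (T \<inter> H i) * ?d (T \<inter> ?K)) u
    = multiaffine (H i) (c i) u * multiaffine ?K ?d u" for u
    using insert.prems(1) insert.hyps(1) by (intro multiaffine_Un disj) auto
  then show ?case
    using IH insert.prems(3)[of i]
    unfolding coeff half_plane_nonzero_def UN_insert ball_Un by auto
qed

section \<open>The star of a vertex\<close>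

lemma sum_Pow_prod:
  fixes u :: "'b \<Rightarrow> complex"
  assumes "finite H"
  shows "(\<Sum>T\<in>Pow H. \<Prod>t\<in>T. u t) = (\<Prod>t\<in>H. 1 + u t)"
  using prod_add[OF assms, of u "\<lambda>_. 1"] by (simp add: add.commute)

text \<open>The proper subsets of \<open>H\<close> are the sets of half-edges that may be left out at a vertex with
  star \<open>H\<close>. Their generating function is \<open>(\<Prod>t. 1 + u t) - (\<Prod>t. u t)\<close>, and in the
  half-plane the first product is strictly larger in modulus than the second.\<close>

lemma half_plane_nonzero_proper_subsets:
  assumes fin: "finite H" and ne: "H \<noteq> {}"
  shows "half_plane_nonzero H (\<lambda>T. if T = H then 0 else 1)"
  unfolding half_plane_nonzero_def
proof (intro allI impI)
  fix u assume u: "\<forall>h\<in>H. Re (u h) > -1/2"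
  have "multiaffine H (\<lambda>T. if T = H then 0 else 1) u
    = (\<Sum>T\<in>Pow H. (\<Prod>t\<in>T. u t) - (if T = H then \<Prod>t\<in>H. u t else 0))"
    unfolding multiaffine_def by (intro sum.cong) auto
  also have "\<dots> = (\<Prod>t\<in>H. 1 + u t) - (\<Prod>t\<in>H. u t)"
    using fin by (simp add: sum_subtractf sum_Pow_prod)
  finally have eq: "multiaffine H (\<lambda>T. if T = H then 0 else 1) u
    = (\<Prod>t\<in>H. 1 + u t) - (\<Prod>t\<in>H. u t)" .
  have less: "norm (u t) < norm (1 + u t)" if "t \<in> H" for t
  proof -
    have "(norm (1 + u t))\<^sup>2 = (norm (u t))\<^sup>2 + (1 + 2 * Re (u t))"
      unfolding cmod_power2 by (simp add: power2_eq_square algebra_simps)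
    moreover have "1 + 2 * Re (u t) > 0" using u that by force
    ultimately have "(norm (u t))\<^sup>2 < (norm (1 + u t))\<^sup>2" by linarith
    then show ?thesis by (rule power_less_imp_less_base) simp
  qed
  obtain h where h: "h \<in> H" using ne by blast
  have "(\<Prod>t\<in>H. norm (u t)) < (\<Prod>t\<in>H. norm (1 + u t))"
  proof (rule prod_mono_strict[where i = h])
    show "norm (u h) < norm (1 + u h)" by (rule less[OF h])
    show "0 \<le> norm (u t) \<and> norm (u t) \<le> norm (1 + u t)" if "t \<in> H" for t
      using less[OF that] by simp
    show "0 < norm (1 + u t)" if "t \<in> H" for t
      using less[OF that] norm_ge_zero by (rule le_less_trans[rotated])
  qed (rule h fin)+
  then have "norm (\<Prod>t\<in>H. u t) < norm (\<Prod>t\<in>H. 1 + u t)" by (simp add: prod_norm)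
  then show "multiaffine H (\<lambda>T. if T = H then 0 else 1) u \<noteq> 0" unfolding eq by auto
qed

section \<open>Roots of the edge cover polynomial\<close>

lemma (in fin_graph) finite_edges: "finite E"
  using edge_subset finite_vertices by (meson Pow_iff finite_Pow_iff finite_subset subsetI)

text \<open>Half-edges are grouped in two ways: by vertices, where the polynomial factors, and by edges,
  where it is contracted.\<close>

lemma edge_cover_complement_sum_nonzero:
  assumes G: "fin_graph V E" and iso: "\<nexists>v. isolated V E v"
    and w: "\<And>k. Re k \<ge> 1/2 \<Longrightarrow> w \<noteq> - k\<^sup>2"
  shows "(\<Sum>F\<in>Pow E. w ^ card F * (if edge_cover V E (E - F) then 1 else 0)) \<noteq> 0"
proof -
  interpret fin_graph V E by (rule G)
  define star where "star v = {v} \<times> {e \<in> E. v \<in> e}" for v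
  define halves where "halves e = e \<times> {e}" for e :: "'a set"
  define c where "c T = (\<Prod>v\<in>V. if T \<inter> star v = star v then 0 else 1 :: complex)" for T
  have half_edges: "(\<Union>v\<in>V. star v) = (\<Union>e\<in>E. halves e)"
    using edge_subset by (auto simp: star_def halves_def)
  have "half_plane_nonzero (\<Union>v\<in>V. star v) c"
    unfolding c_def
  proof (rule half_plane_nonzero_UN)
    show "half_plane_nonzero (star v) (\<lambda>T. if T = star v then 0 else 1)" if "v \<in> V" for v
      using iso that finite_edges
      by (intro half_plane_nonzero_proper_subsets) (auto simp: star_def isolated_def)
  qed (use finite_vertices finite_edges in \<open>auto simp: star_def disjoint_family_on_def\<close>)
  then have "half_plane_nonzero (\<Union>e\<in>E. halves e) c"
    by (simp add: half_edges)
  then have "(\<Sum>F\<in>Pow E. w ^ card F * c (\<Union>e\<in>F. halves e)) \<noteq> 0"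
    using finite_edges card_edge
    by (intro contract_all_pairs w) (auto simp: halves_def disjoint_family_on_def card_cartesian_product)
  moreover have "c (\<Union>e\<in>F. halves e) = (if edge_cover V E (E - F) then 1 else 0)"
    if "F \<in> Pow E" for F
  proof -
    have full: "(\<Union>e\<in>F. halves e) \<inter> star v = star v \<longleftrightarrow> \<not> (\<exists>e\<in>E - F. v \<in> e)" for v
      by (auto simp: halves_def star_def)
    show ?thesis
    proof (cases "edge_cover V E (E - F)")
      case True
      then show ?thesis unfolding c_def full edge_cover_def by (auto intro: prod.neutral)
    next
      case False
      then have "\<exists>v\<in>V. \<not> (\<exists>e\<in>E - F. v \<in> e)" by (auto simp: edge_cover_def)
      with False show ?thesis
        unfolding c_def full using finite_vertices by (auto intro: prod_zero)
    qed
  qed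
  ultimately show ?thesis by simp
qed

lemma poly_edge_cover_poly_reversed:
  assumes finE: "finite E" and z: "z \<noteq> 0"
  shows "(\<Sum>F\<in>Pow E. (1 / z) ^ card F * (if edge_cover V E (E - F) then 1 else 0))
    = (1 / z) ^ card E * poly (edge_cover_poly V E) z"
proof -
  have "(\<Sum>F\<in>Pow E. (1 / z) ^ card F * (if edge_cover V E (E - F) then 1 else 0))
    = (\<Sum>F\<in>Pow E. (1 / z) ^ card E * (if edge_cover V E F then z ^ card F else 0))"
  proof (rule sum.reindex_bij_witness[where i = "\<lambda>F. E - F" and j = "\<lambda>F. E - F"])
    fix F assume F: "F \<in> Pow E"
    then have "card E = card F + card (E - F)"
      using finE by (simp add: card_Diff_subset card_mono finite_subset)
    then have "(1 / z) ^ card E * z ^ card (E - F) = (1 / z) ^ card F"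
      using z by (simp add: power_add power_divide)
    then show "(1 / z) ^ card E * (if edge_cover V E (E - F) then z ^ card (E - F) else 0)
      = (1 / z) ^ card F * (if edge_cover V E (E - F) then 1 else 0)" by simp
  qed auto
  also have "\<dots> = (1 / z) ^ card E * (\<Sum>F | F \<in> Pow E \<and> edge_cover V E F. z ^ card F)"
    using finE by (subst sum.inter_filter) (auto simp: sum_distrib_left)
  also have "{F. F \<in> Pow E \<and> edge_cover V E F} = {F. edge_cover V E F}"
    by (auto simp: edge_cover_def)
  finally show ?thesis
    by (simp add: edge_cover_poly_def poly_sum poly_monom)
qed

lemma inverse_half_plane_in_disc:
  assumes "Re k \<ge> 1/2"
  obtains \<alpha> where "norm \<alpha> \<le> 1" "1 / k = 1 - \<alpha>"
proof
  have k: "k \<noteq> 0" using assms by auto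
  have "(norm (k - 1))\<^sup>2 = (norm k)\<^sup>2 + (1 - 2 * Re k)"
    unfolding cmod_power2 by (simp add: power2_eq_square algebra_simps)
  then have "(norm (k - 1))\<^sup>2 \<le> (norm k)\<^sup>2" using assms by linarith
  then have "norm (k - 1) \<le> norm k" by (rule power2_le_imp_le) simp
  then have "norm ((k - 1) / k) \<le> 1" using k by (simp add: norm_divide)
  then show "norm (1 - 1 / k) \<le> 1" using k by (simp add: diff_divide_distrib)
  show "1 / k = 1 - (1 - 1 / k)" by simp
qed

theorem theorem1p5:
  fixes V :: "'a set" and E :: "'a set set"
  assumes "fin_graph V E"
    and "\<nexists>v. isolated V E v"
  shows "{z. poly (edge_cover_poly V E) z = 0} \<subseteq> {- (1 - \<alpha>)\<^sup>2 | \<alpha> :: complex. norm \<alpha> \<le> 1}"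
proof
  fix z assume "z \<in> {z. poly (edge_cover_poly V E) z = 0}"
  then have root: "poly (edge_cover_poly V E) z = 0" by simp
  have finE: "finite E" using assms(1) by (rule fin_graph.finite_edges)
  show "z \<in> {- (1 - \<alpha>)\<^sup>2 | \<alpha> :: complex. norm \<alpha> \<le> 1}"
  proof (cases "z = 0")
    case True
    then show ?thesis by (intro CollectI exI[of _ 1]) simp
  next
    case False
    from root have "(\<Sum>F\<in>Pow E. (1 / z) ^ card F * (if edge_cover V E (E - F) then 1 else 0)) = 0"
      using poly_edge_cover_poly_reversed[OF finE False] by simp
    then obtain k where k: "Re k \<ge> 1/2" "1 / z = - k\<^sup>2"
      using edge_cover_complement_sum_nonzero[OF assms, of "1 / z"] by blast
    obtain \<alpha> where \<alpha>: "norm \<alpha> \<le> 1" "1 / k = 1 - \<alpha>"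
      using k(1) by (rule inverse_half_plane_in_disc)
    have "z = 1 / (1 / z)" by simp
    also have "\<dots> = - (1 / k)\<^sup>2" unfolding k(2) by (simp add: power_divide)
    finally have "z = - (1 - \<alpha>)\<^sup>2" unfolding \<alpha>(2) .
    with \<alpha>(1) show ?thesis by blast
  qed
qed

end
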